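(* Let $K \subseteq L_1 \subseteq L_2$ be arbitrary field extensions, and assume that either $\operatorname{tr\,deg}_K L_1 = \operatorname{tr\,deg}_K L_2 < \aleph_0$, or both $\operatorname{tr\,deg}_K L_1 \geq \aleph_0$ and $\operatorname{tr\,deg}_K L_2 \geq \aleph_0$. Then $(L_1,\mathcal{L}) \prec_1 (L_2,\mathcal{L})$, i.e. for every $\mathcal{L}$-sentence $\psi$ with one quantifier and parameters from $L_1$ we have $(L_1,\mathcal{L}) \models \psi$ if and only if $(L_2,\mathcal{L}) \models \psi$.
   Context: Work inside a large algebraically closed field $\mathfrak{C}$; $\widehat{F}$ denotes the algebraic closure of $F$ in $\mathfrak{C}$ and $\operatorname{acl}_K(X)=\widehat{K(X)}$. $\mathcal{L} = \{\operatorname{acl}_n : n \in \mathbb{N}\}$ is the countable first-order language where $\operatorname{acl}_n$ is an $(n+1)$-ary relation symbol. For a field $L\supseteq K$, $(L,\mathcal{L})$ is the $\mathcal L$-structure with universe $L$ in which $\operatorname{acl}_n(a_0,\dots,a_n)$ holds iff $a_0 \in \operatorname{acl}_K(a_1,\dots,a_n)$. A sentence "with one quantifier" is one of the form $\exists x\,\varphi$ or $\forall x\,\varphi$ with $\varphi$ quantifier-free.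
   Formalization: Sentences are built from the relations acl_n only, without equality; with equality as a logical symbol the claim fails, e.g. for K = L_1 = F_2, L_2 = F_4 and the sentence "there is x with x ≠ 0 and x ≠ 1". *)

theory Defs
  imports "HOL-Algebra.Algebra"
begin

unbundle cardinal_syntax

text \<open>
  The ambient ring of the locale plays the role of the big field; all fields involved are subfields
  of it. No lower bound on its size is needed beyond containing those fields.
\<close>

definition (in ring) alg_hull :: "'a set \<Rightarrow> 'a set" where
  "alg_hull F = {x \<in> carrier R. (algebraic over F) x}"

definition (in ring) acl :: "'a set \<Rightarrow> 'a set \<Rightarrow> 'a set" where
  "acl K S = alg_hull (generate_field R (K \<union> S))"

definition (in ring) alg_independent :: "'a set \<Rightarrow> 'a set \<Rightarrow> bool" where
  "alg_independent K S \<longleftrightarrow>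
     S \<subseteq> carrier R \<and> (\<forall>s\<in>S. (transcendental over (generate_field R (K \<union> (S - {s})))) s)"

definition (in ring) transcendence_basis :: "'a set \<Rightarrow> 'a set \<Rightarrow> 'a set \<Rightarrow> bool" where
  "transcendence_basis K L B \<longleftrightarrow> B \<subseteq> L \<and> alg_independent K B \<and> L \<subseteq> acl K B"

text \<open>
  The transcendence degree is a cardinal. A transcendence basis exists, and all of them have the
  same cardinality, whenever \<open>K \<subseteq> L\<close> are subfields of a field.
\<close>

definition (in ring) tr_deg :: "'a set \<Rightarrow> 'a set \<Rightarrow> 'a rel" where
  "tr_deg K L = |SOME B. transcendence_basis K L B|"

text \<open>
  \<open>Acl t ts\<close> is the atomic formula \<open>acl\<^sub>n(t, t\<^sub>1, \<dots>, t\<^sub>n)\<close> where \<open>ts = [t\<^sub>1, \<dots>, t\<^sub>n]\<close>: the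
  length of \<open>ts\<close> determines which of the symbols is meant.

  The \<open>acl\<^sub>n\<close> are the only predicates; equality is not a logical symbol. With equality, elementarity
  for one quantifier fails in general: for \<open>K = L\<^sub>1\<close> the field with two elements and \<open>L\<^sub>2\<close> the field
  with four (both of transcendence degree \<open>0\<close>), consider \<open>\<exists>x. x \<noteq> 0 \<and> x \<noteq> 1\<close>.
\<close>

datatype (tm_params: 'p) tm = Var nat | Param 'p

datatype (params: 'p) fm =
    Falsum
  | Acl "'p tm" "'p tm list"
  | Neg "'p fm"
  | Conj "'p fm" "'p fm"
  | Disj "'p fm" "'p fm"
  | Exists nat "'p fm"
  | Forall nat "'p fm"

primrec tm_vars :: "'p tm \<Rightarrow> nat set" where
  "tm_vars (Var x) = {x}"
| "tm_vars (Param a) = {}"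

primrec free_vars :: "'p fm \<Rightarrow> nat set" where
  "free_vars Falsum = {}"
| "free_vars (Acl t ts) = tm_vars t \<union> (\<Union>s\<in>set ts. tm_vars s)"
| "free_vars (Neg \<phi>) = free_vars \<phi>"
| "free_vars (Conj \<phi> \<psi>) = free_vars \<phi> \<union> free_vars \<psi>"
| "free_vars (Disj \<phi> \<psi>) = free_vars \<phi> \<union> free_vars \<psi>"
| "free_vars (Exists x \<phi>) = free_vars \<phi> - {x}"
| "free_vars (Forall x \<phi>) = free_vars \<phi> - {x}"

definition sentence :: "'p fm \<Rightarrow> bool" where
  "sentence \<phi> \<longleftrightarrow> free_vars \<phi> = {}"

primrec quantifier_free :: "'p fm \<Rightarrow> bool" where
  "quantifier_free Falsum = True"
| "quantifier_free (Acl t ts) = True"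
| "quantifier_free (Neg \<phi>) = quantifier_free \<phi>"
| "quantifier_free (Conj \<phi> \<psi>) = (quantifier_free \<phi> \<and> quantifier_free \<psi>)"
| "quantifier_free (Disj \<phi> \<psi>) = (quantifier_free \<phi> \<and> quantifier_free \<psi>)"
| "quantifier_free (Exists x \<phi>) = False"
| "quantifier_free (Forall x \<phi>) = False"

definition one_quantifier :: "'p fm \<Rightarrow> bool" where
  "one_quantifier \<psi> \<longleftrightarrow> (\<exists>x \<phi>. quantifier_free \<phi> \<and> (\<psi> = Exists x \<phi> \<or> \<psi> = Forall x \<phi>))"

text \<open>
  \<open>acl_rel M a [a\<^sub>1, \<dots>, a\<^sub>n]\<close> is the interpretation of \<open>acl\<^sub>n\<close> in \<open>M\<close>.
\<close>

record 'a acl_structure =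
  universe :: "'a set"
  acl_rel :: "'a \<Rightarrow> 'a list \<Rightarrow> bool"

primrec tm_val :: "(nat \<Rightarrow> 'a) \<Rightarrow> 'a tm \<Rightarrow> 'a" where
  "tm_val e (Var x) = e x"
| "tm_val e (Param a) = a"

primrec sat :: "'a acl_structure \<Rightarrow> (nat \<Rightarrow> 'a) \<Rightarrow> 'a fm \<Rightarrow> bool" where
  "sat M e Falsum \<longleftrightarrow> False"
| "sat M e (Acl t ts) \<longleftrightarrow> acl_rel M (tm_val e t) (map (tm_val e) ts)"
| "sat M e (Neg \<phi>) \<longleftrightarrow> \<not> sat M e \<phi>"
| "sat M e (Conj \<phi> \<psi>) \<longleftrightarrow> sat M e \<phi> \<and> sat M e \<psi>"
| "sat M e (Disj \<phi> \<psi>) \<longleftrightarrow> sat M e \<phi> \<or> sat M e \<psi>"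
| "sat M e (Exists x \<phi>) \<longleftrightarrow> (\<exists>a\<in>universe M. sat M (e(x := a)) \<phi>)"
| "sat M e (Forall x \<phi>) \<longleftrightarrow> (\<forall>a\<in>universe M. sat M (e(x := a)) \<phi>)"

definition models :: "'a acl_structure \<Rightarrow> 'a fm \<Rightarrow> bool" (infix \<open>\<Turnstile>\<close> 50) where
  "M \<Turnstile> \<psi> \<longleftrightarrow> (\<forall>e. range e \<subseteq> universe M \<longrightarrow> sat M e \<psi>)"

definition elementary_sub1 :: "'a acl_structure \<Rightarrow> 'a acl_structure \<Rightarrow> bool" (infix \<open>\<prec>\<^sub>1\<close> 50) where
  "M \<prec>\<^sub>1 N \<longleftrightarrow>
     universe M \<subseteq> universe N \<and>
     (\<forall>\<psi>. sentence \<psi> \<and> one_quantifier \<psi> \<and> params \<psi> \<subseteq> universe M \<longrightarrow>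
          (M \<Turnstile> \<psi> \<longleftrightarrow> N \<Turnstile> \<psi>))"

definition (in ring) acl_struct :: "'a set \<Rightarrow> 'a set \<Rightarrow> 'a acl_structure" where
  "acl_struct K L = \<lparr>universe = L, acl_rel = (\<lambda>a as. a \<in> acl K (set as))\<rparr>"

end

theory Submission
  imports Defs
begin

text \<open>
  The operator \<open>acl K\<close> is a pregeometry, and by exchange the quantifier-free type of a point \<open>x\<close> over a
  finite set \<open>A\<close> is determined by its trace, the family of all \<open>S \<subseteq> A\<close> with \<open>x \<in> acl K S\<close>. So it
  suffices to realize in \<open>L\<^sub>1\<close> the trace over \<open>A \<subseteq> L\<^sub>1\<close> of a given \<open>x \<in> L\<^sub>2\<close>. If \<open>x \<notin> acl K A\<close>, the trace is
  empty, and any point of \<open>L\<^sub>1\<close> outside \<open>acl K A\<close> will do; it exists because of the assumption on the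
  transcendence degrees. If \<open>x \<in> acl K A\<close>, then \<open>x\<close> is algebraic over \<open>L\<^sub>1\<close>, and the coefficients of its
  minimal polynomial over \<open>L\<^sub>1\<close> lie in \<open>acl K S\<close> exactly when \<open>x\<close> does, all its conjugates being algebraic
  over whatever subfield of \<open>L\<^sub>1\<close> makes \<open>x\<close> algebraic. A field is not covered by finitely many
  relatively algebraically closed proper subfields, which turns the tuple of coefficients into a
  single element of \<open>L\<^sub>1\<close> with the same trace.
\<close>

subsection \<open>Pregeometries\<close>

text \<open>\<open>cl_least\<close> packs monotonicity and idempotence into the single form in which
  closures are compared.\<close>

locale pregeometry =
  fixes E :: "'a set" and cl :: "'a set \<Rightarrow> 'a set"
  assumes cl_in_carrier: "S \<subseteq> E \<Longrightarrow> cl S \<subseteq> E"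
    and cl_extensive: "S \<subseteq> E \<Longrightarrow> S \<subseteq> cl S"
    and cl_least: "T \<subseteq> E \<Longrightarrow> S \<subseteq> cl T \<Longrightarrow> cl S \<subseteq> cl T"
    and cl_finitary: "S \<subseteq> E \<Longrightarrow> x \<in> cl S \<Longrightarrow> \<exists>T\<subseteq>S. finite T \<and> x \<in> cl T"
    and cl_exchange: "S \<subseteq> E \<Longrightarrow> a \<in> E \<Longrightarrow> x \<in> cl (insert a S) \<Longrightarrow> x \<notin> cl S \<Longrightarrow> a \<in> cl (insert x S)"
begin

definition indep :: "'a set \<Rightarrow> bool" where
  "indep S \<longleftrightarrow> S \<subseteq> E \<and> (\<forall>s\<in>S. s \<notin> cl (S - {s}))"

lemma cl_mono: "S \<subseteq> T \<Longrightarrow> T \<subseteq> E \<Longrightarrow> cl S \<subseteq> cl T"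
  using cl_least cl_extensive by blast

lemma indep_subset: "indep B \<Longrightarrow> A \<subseteq> B \<Longrightarrow> indep A"
proof -
  assume B: "indep B" and "A \<subseteq> B"
  then have "cl (A - {s}) \<subseteq> cl (B - {s})" for s
    by (intro cl_mono) (auto simp: indep_def)
  with B \<open>A \<subseteq> B\<close> show "indep A" unfolding indep_def by blast
qed

text \<open>If an old point \<open>s\<close> depended on \<open>x\<close> and the remaining points,
  exchange would put \<open>x\<close> into the closure of \<open>B\<close>, since \<open>s\<close>
  together with those remaining points gives back \<open>B\<close>.\<close>

lemma indep_insert:
  assumes "indep B" "x \<in> E" "x \<notin> cl B"
  shows "indep (insert x B)"
  unfolding indep_def
proof (intro conjI ballI)
  have B: "B \<subseteq> E" using assms(1) by (simp add: indep_def)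
  then have xB: "x \<notin> B" using assms(3) cl_extensive by blast
  show "insert x B \<subseteq> E" using B assms(2) by simp
  fix s assume s: "s \<in> insert x B"
  show "s \<notin> cl (insert x B - {s})"
  proof (cases "s = x")
    case True
    then show ?thesis using assms(3) xB by simp
  next
    case False
    then have sB: "s \<in> B" and eq: "insert x B - {s} = insert x (B - {s})" using s by auto
    show ?thesis
    proof
      assume "s \<in> cl (insert x B - {s})"
      moreover have "s \<notin> cl (B - {s})" using assms(1) sB by (simp add: indep_def)
      ultimately have "x \<in> cl (insert s (B - {s}))"
        using cl_exchange[of "B - {s}" x s] B assms(2) eq by auto
      then show False using assms(3) sB by (simp add: insert_absorb)
    qed
  qed
qed

text \<open>A dependence in the union is witnessed by finitely many points, and these already lie
  together in one member of the chain.\<close>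

lemma indep_Union_chain:
  assumes "subset.chain {B. B \<subseteq> L \<and> indep B} \<C>"
  shows "indep (\<Union>\<C>)"
  unfolding indep_def
proof (intro conjI ballI)
  have mem: "\<And>B. B \<in> \<C> \<Longrightarrow> indep B" and chain: "\<And>B B'. B \<in> \<C> \<Longrightarrow> B' \<in> \<C> \<Longrightarrow> B \<subseteq> B' \<or> B' \<subseteq> B"
    using assms by (auto simp: subset_chain_def)
  show sub: "\<Union>\<C> \<subseteq> E" using mem by (auto simp: indep_def)
  fix s assume s: "s \<in> \<Union>\<C>"
  show "s \<notin> cl (\<Union>\<C> - {s})"
  proof
    assume "s \<in> cl (\<Union>\<C> - {s})"
    then obtain T where T: "T \<subseteq> \<Union>\<C> - {s}" "finite T" "s \<in> cl T"
      using cl_finitary[of "\<Union>\<C> - {s}" s] sub by blast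
    have "finite (insert s T)" "insert s T \<subseteq> \<Union>\<C>" using T s by auto
    then obtain B where B: "B \<in> \<C>" "insert s T \<subseteq> B"
      using finite_subset_Union_chain[of "insert s T" \<C> "{B. B \<subseteq> L \<and> indep B}"] assms s
      by blast
    then have "T \<subseteq> B - {s}" "B \<subseteq> E" using T(1) mem by (auto simp: indep_def)
    then have "cl T \<subseteq> cl (B - {s})" using cl_mono by blast
    then show False using T(3) B mem unfolding indep_def by blast
  qed
qed

text \<open>Zorn's lemma gives a maximal independent subset of \<open>L\<close>; a point of
  \<open>L\<close> outside its closure could be added to it.\<close>

lemma basis_exists:
  assumes "L \<subseteq> E"
  shows "\<exists>B. B \<subseteq> L \<and> indep B \<and> L \<subseteq> cl B"
proof -
  have "\<exists>M\<in>{B. B \<subseteq> L \<and> indep B}. \<forall>Y\<in>{B. B \<subseteq> L \<and> indep B}. M \<subseteq> Y \<longrightarrow> Y = M"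
  proof (rule subset_Zorn')
    fix \<C> assume "subset.chain {B. B \<subseteq> L \<and> indep B} \<C>"
    then show "\<Union>\<C> \<in> {B. B \<subseteq> L \<and> indep B}"
      using indep_Union_chain by (auto simp: subset_chain_def)
  qed
  then obtain M where M: "M \<subseteq> L" "indep M"
    and max: "\<And>Y. Y \<subseteq> L \<Longrightarrow> indep Y \<Longrightarrow> M \<subseteq> Y \<Longrightarrow> Y = M"
    by auto
  have "x \<in> cl M" if "x \<in> L" for x
  proof (rule ccontr)
    assume "x \<notin> cl M"
    then have "indep (insert x M)" using indep_insert[OF M(2)] that assms by blast
    then have "x \<in> M" using max[of "insert x M"] that M(1) by auto
    then show False using \<open>x \<notin> cl M\<close> cl_extensive M(1) assms by blast
  qed
  then show ?thesis using M by blast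
qed

text \<open>Steinitz exchange: some \<open>b\<close> in \<open>B\<close> but not in \<open>A\<close>
  is replaced by a point of \<open>A\<close>, which keeps independence and size and leaves one point
  fewer outside \<open>A\<close>.\<close>

lemma finite_indep_card_le:
  assumes "finite A" "A \<subseteq> E" "finite B" "indep B" "B \<subseteq> cl A"
  shows "card B \<le> card A"
  using assms(3-5)
proof (induction "card (B - A)" arbitrary: B)
  case 0
  then show ?case using assms(1) by (simp add: card_mono)
next
  case (Suc n)
  then obtain b where b: "b \<in> B" "b \<notin> A" by (metis Diff_iff card.empty ex_in_conv nat.distinct(1))
  have BE: "B \<subseteq> E" and nb: "b \<notin> cl (B - {b})" using Suc.prems b by (auto simp: indep_def)
  \<comment> \<open>Otherwise \<open>cl A\<close>, and with it \<open>b\<close>, would lie in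
    \<open>cl (B - {b})\<close>.\<close>
  have "\<not> A \<subseteq> cl (B - {b})"
    using cl_least[of "B - {b}" A] BE nb Suc.prems(3) b(1) by blast
  then obtain a where a: "a \<in> A" "a \<notin> cl (B - {b})" by blast
  let ?B = "insert a (B - {b})"
  have aB: "a \<notin> B - {b}" using a(2) cl_extensive[of "B - {b}"] BE by blast
  have "indep ?B"
    using indep_insert[OF indep_subset[OF Suc.prems(2)]] a assms(2) by blast
  moreover have "card (?B - A) = n"
  proof -
    have "?B - A = (B - A) - {b}" using a by auto
    then show ?thesis using Suc.hyps(2) b Suc.prems(1) by simp
  qed
  moreover have "?B \<subseteq> cl A" using Suc.prems(3) a(1) cl_extensive assms(2) by blast
  ultimately have "card ?B \<le> card A" using Suc.hyps(1)[of ?B] Suc.prems(1) by simp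
  moreover have "card ?B = card B"
    using aB card.remove[OF Suc.prems(1) b(1)] Suc.prems(1) by (metis card_insert_disjoint finite_Diff)
  ultimately show ?case by simp
qed

lemma indep_card_le:
  assumes "finite A" "A \<subseteq> E" "indep B" "B \<subseteq> cl A"
  shows "finite B \<and> card B \<le> card A"
proof -
  have "finite B"
  proof (rule ccontr)
    assume "infinite B"
    then obtain T where "T \<subseteq> B" "finite T" "card T = Suc (card A)"
      using infinite_arbitrarily_large by metis
    then show False
      using finite_indep_card_le[of A T] assms indep_subset[of B T] by auto
  qed
  then show ?thesis using finite_indep_card_le assms by blast
qed

text \<open>By exchange, a closure generated with the help of \<open>x\<close> is described by
  closures that are only asked whether they contain \<open>x\<close>, that is, by the trace of
  \<open>x\<close>.\<close>

lemma mem_cl_insert_iff: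
  assumes "S \<subseteq> E" "x \<in> E" "b \<in> E"
  shows "b \<in> cl (insert x S) \<longleftrightarrow> b \<in> cl S \<or> (x \<notin> cl S \<and> x \<in> cl (insert b S))"
proof
  assume b: "b \<in> cl (insert x S)"
  show "b \<in> cl S \<or> (x \<notin> cl S \<and> x \<in> cl (insert b S))"
  proof (cases "b \<in> cl S")
    case False
    moreover have "x \<notin> cl S"
      using cl_least[of S "insert x S"] cl_extensive[of S] assms b False by blast
    ultimately show ?thesis using cl_exchange[of S x b] assms b by simp
  qed simp
next
  assume "b \<in> cl S \<or> (x \<notin> cl S \<and> x \<in> cl (insert b S))"
  then show "b \<in> cl (insert x S)"
    using cl_mono[of S "insert x S"] cl_exchange[of S b x] assms by blast
qed

text \<open>Only atoms matter. If the variable stands on the left, its trace decides, unless it also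
  stands on the right and the atom is true. If it stands only on the right,
  \<open>mem_cl_insert_iff\<close> moves it to the left.\<close>

lemma sat_cong_trace:
  assumes "A \<subseteq> E" "x \<in> E" "x' \<in> E"
    and trace: "\<And>S. S \<subseteq> A \<Longrightarrow> x \<in> cl S \<longleftrightarrow> x' \<in> cl S"
    and "acl_rel M = (\<lambda>a as. a \<in> cl (set as))" "acl_rel N = (\<lambda>a as. a \<in> cl (set as))"
    and "quantifier_free \<phi>" "free_vars \<phi> \<subseteq> {v}" "params \<phi> \<subseteq> A"
  shows "sat M (e(v := x)) \<phi> \<longleftrightarrow> sat N (e'(v := x')) \<phi>"
  using assms(7-9)
proof (induction \<phi>)
  case (Acl t ts)
  have atom: "s = Var v \<or> (\<exists>p\<in>A. s = Param p)" if "s \<in> insert t (set ts)" for s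
  proof -
    have "tm_vars s \<subseteq> free_vars (Acl t ts)" "tm_params s \<subseteq> params (Acl t ts)" using that by auto
    then show ?thesis using Acl.prems(2,3) by (cases s) auto
  qed
  define S where "S = {p. Param p \<in> set ts}"
  have S: "S \<subseteq> A" using atom by (fastforce simp: S_def)
  have vals: "tm_val (d(v := y)) ` set ts = (if Var v \<in> set ts then insert y S else S)" for d y
    using atom by (force simp: S_def image_iff)
  have "b \<in> cl (insert x S) \<longleftrightarrow> b \<in> cl (insert x' S)" if "b \<in> A" for b
    using mem_cl_insert_iff[of S x b] mem_cl_insert_iff[of S x' b] trace[of S] trace[of "insert b S"]
      that S assms(1-3) by auto
  moreover have "x \<in> cl (insert x S)" "x' \<in> cl (insert x' S)"
    using cl_extensive[of "insert x S"] cl_extensive[of "insert x' S"] S assms(1-3) by auto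
  ultimately show ?case
    using atom[of t] trace[OF S] S assms(5,6)
    by (auto simp: vals split: if_splits simp del: fun_upd_apply) (auto simp: vals[unfolded fun_upd_def])
qed auto

end

section \<open>Environments, parameters and reduction to existential sentences\<close>

lemma sat_cong_free_vars:
  assumes "quantifier_free \<phi>" "\<And>v. v \<in> free_vars \<phi> \<Longrightarrow> e v = e' v"
  shows "sat M e \<phi> = sat M e' \<phi>"
  using assms
proof (induction \<phi>)
  case (Acl t ts)
  have "tm_val e s = tm_val e' s" if "s \<in> insert t (set ts)" for s
  proof -
    have "tm_vars s \<subseteq> free_vars (Acl t ts)" using that by auto
    then show ?thesis using Acl.prems(2) by (cases s) auto
  qed
  then have "tm_val e t = tm_val e' t" "map (tm_val e) ts = map (tm_val e') ts" by auto
  then show ?case by (simp del: map_eq_conv)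
qed auto

lemma finite_params: "finite (params \<phi>)"
proof -
  have "finite (tm_params t)" for t :: "'a tm" by (cases t) auto
  then show ?thesis by (induction \<phi>) auto
qed

text \<open>A universal sentence is handled by the hypothesis for \<open>Neg \<phi>\<close>. As
  \<open>models\<close> ranges over all environments, a point of the nonempty universe supplies one
  constant environment at which both structures can be compared.\<close>

lemma elementary_sub1I:
  assumes sub: "universe M \<subseteq> universe N" and ne: "universe M \<noteq> {}"
    and ex: "\<And>v \<phi> e. quantifier_free \<phi> \<Longrightarrow> free_vars \<phi> \<subseteq> {v} \<Longrightarrow> params \<phi> \<subseteq> universe M \<Longrightarrow>
      (\<exists>a\<in>universe M. sat M (e(v := a)) \<phi>) \<longleftrightarrow> (\<exists>a\<in>universe N. sat N (e(v := a)) \<phi>)"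
  shows "M \<prec>\<^sub>1 N"
  unfolding elementary_sub1_def
proof (intro conjI allI impI sub)
  fix \<psi> assume \<psi>: "sentence \<psi> \<and> one_quantifier \<psi> \<and> params \<psi> \<subseteq> universe M"
  then obtain v \<phi> where qf: "quantifier_free \<phi>" and \<psi>_eq: "\<psi> = Exists v \<phi> \<or> \<psi> = Forall v \<phi>"
    unfolding one_quantifier_def by blast
  have fv: "free_vars \<phi> \<subseteq> {v}" and par: "params \<phi> \<subseteq> universe M"
    using \<psi> \<psi>_eq by (auto simp: sentence_def)
  have eq: "sat M e \<psi> = sat N e \<psi>" for e
    using \<psi>_eq ex[OF qf fv par, of e] ex[of "Neg \<phi>" v e] qf fv par by auto
  have env: "sat P e \<psi> = sat P e' \<psi>" for P e e'
  proof -
    have "sat P (e(v := a)) \<phi> = sat P (e'(v := a)) \<phi>" for a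
      by (rule sat_cong_free_vars[OF qf]) (use fv in auto)
    then show ?thesis using \<psi>_eq by auto
  qed
  obtain m where "m \<in> universe M" using ne by blast
  then have "range (\<lambda>_::nat. m) \<subseteq> universe M" "range (\<lambda>_::nat. m) \<subseteq> universe N" using sub by auto
  then have "P \<Turnstile> \<psi> \<longleftrightarrow> sat P (\<lambda>_. m) \<psi>" if "P = M \<or> P = N" for P
    unfolding models_def using env that by blast
  then show "M \<Turnstile> \<psi> \<longleftrightarrow> N \<Turnstile> \<psi>" using eq by blast
qed

subsection \<open>Algebraic closure as a pregeometry\<close>

lemma (in abelian_monoid) finsum_swap_nat:
  fixes n m :: nat
  assumes "\<And>i j. i < n \<Longrightarrow> j < m \<Longrightarrow> f i j \<in> carrier G"
  shows "(\<Oplus>i\<in>{..<n}. \<Oplus>j\<in>{..<m}. f i j) = (\<Oplus>j\<in>{..<m}. \<Oplus>i\<in>{..<n}. f i j)"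
  using assms
proof (induction n)
  case (Suc n)
  have "(\<Oplus>i\<in>{..<Suc n}. \<Oplus>j\<in>{..<m}. f i j)
      = (\<Oplus>j\<in>{..<m}. f n j) \<oplus> (\<Oplus>j\<in>{..<m}. \<Oplus>i\<in>{..<n}. f i j)"
    using Suc by (simp add: lessThan_Suc finsum_insert Pi_iff)
  also have "\<dots> = (\<Oplus>j\<in>{..<m}. f n j \<oplus> (\<Oplus>i\<in>{..<n}. f i j))"
    using Suc.prems by (simp add: finsum_addf Pi_iff)
  also have "\<dots> = (\<Oplus>j\<in>{..<m}. \<Oplus>i\<in>{..<Suc n}. f i j)"
    using Suc.prems by (intro finsum_cong') (auto simp: lessThan_Suc finsum_insert Pi_iff)
  finally show ?case .
qed simp

context ring
begin

text \<open>The bound \<open>n\<close> may exceed the length of \<open>p\<close>, the extra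
  coefficients being zero; this lets several polynomials be expanded over one index range.\<close>

lemma eval_eq_finsum:
  assumes "set p \<subseteq> carrier R" "x \<in> carrier R" "length p \<le> n"
  shows "eval p x = (\<Oplus>i\<in>{..<n}. coeff p i \<otimes> x [^] i)"
  using assms(1,3)
proof (induction n arbitrary: p)
  case (Suc n)
  show ?case
  proof (cases "length p \<le> n")
    case True
    then have "coeff p n = \<zero>" using coeff_length by blast
    then show ?thesis
      using Suc.IH[of p] Suc.prems True assms(2)
      by (simp add: lessThan_Suc finsum_insert Pi_iff)
  next
    case False
    then obtain a q where p: "p = a # q" "length q = n"
      using Suc.prems(2) by (metis Suc_length_conv le_Suc_eq)
    have "eval p x = a \<otimes> x [^] n \<oplus> (\<Oplus>i\<in>{..<n}. coeff q i \<otimes> x [^] i)"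
      using Suc.IH[of q] Suc.prems p by simp
    also have "(\<Oplus>i\<in>{..<n}. coeff q i \<otimes> x [^] i) = (\<Oplus>i\<in>{..<n}. coeff p i \<otimes> x [^] i)"
      using Suc.prems p assms(2) by (intro finsum_cong') auto
    finally show ?thesis
      using Suc.prems p assms(2) by (simp add: lessThan_Suc finsum_insert Pi_iff)
  qed
qed simp

text \<open>Coefficient lists start with the leading coefficient, hence the reversal.\<close>

lemma coeff_map_rev_upt:
  "coeff (map c (rev [0..<n])) i = (if i < n then c i else \<zero>)"
  by (induction n) (auto simp: less_Suc_eq)

lemma finsum_in_subring:
  assumes "subring H R" "\<And>i. i \<in> A \<Longrightarrow> f i \<in> H" "finite A"
  shows "(\<Oplus>i\<in>A. f i) \<in> H"
  using assms(3,2)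
proof (induction A)
  case (insert a A)
  then have "f \<in> A \<rightarrow> carrier R" "f a \<in> carrier R"
    using subringE(1)[OF assms(1)] by auto
  then show ?case
    using insert subringE(7)[OF assms(1)] by (simp add: finsum_insert)
qed (simp add: subringE(2)[OF assms(1)])

lemma nat_pow_in_subring:
  assumes "subring H R" "x \<in> H"
  shows "x [^] (n::nat) \<in> H"
  using assms subringE(3,6)[OF assms(1)] by (induction n) auto

lemma transcendental_finsum_eq_zero:
  fixes n :: nat
  assumes "subring H R" "x \<in> carrier R" "(transcendental over H) x"
    and "\<And>i. i < n \<Longrightarrow> c i \<in> H" "(\<Oplus>i\<in>{..<n}. c i \<otimes> x [^] i) = \<zero>" "i < n"
  shows "c i = \<zero>"
proof -
  define p where "p = map c (rev [0..<n])"
  have coeff_p: "coeff p j = (if j < n then c j else \<zero>)" for j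
    unfolding p_def by (rule coeff_map_rev_upt)
  have p: "set p \<subseteq> H" "length p = n" using assms(4) by (auto simp: p_def)
  then have pC: "set p \<subseteq> carrier R" using subringE(1)[OF assms(1)] by blast
  have "eval p x = (\<Oplus>i\<in>{..<n}. c i \<otimes> x [^] i)"
    unfolding eval_eq_finsum[OF pC assms(2), of n, unfolded p(2), OF order_refl]
    using assms(2,4) subringE(1)[OF assms(1)] by (intro finsum_cong') (auto simp: coeff_p)
  \<comment> \<open>The list \<open>p\<close> may begin with zeros, so it is normalized to become a
    polynomial.\<close>
  then have "eval (normalize p) x = \<zero>"
    using eval_normalize[OF pC assms(2)] assms(5) by simp
  moreover have "normalize p \<in> carrier (H[X])"
    using normalize_gives_polynomial[OF p(1)] univ_poly_carrier by blast
  ultimately have "normalize p = []" using eval_transcendental[OF assms(3)] by blast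
  then have "coeff p i = \<zero>" using normalize_coeff[of p] by simp
  then show ?thesis using coeff_p assms(6) by simp
qed

end

section \<open>Fractions and the exchange property\<close>

context field
begin

text \<open>This is the fraction field of \<open>D\<close> inside the ambient field. Sums and
  products use the product of two denominators; for an inverse, the numerator
  \<open>d \<otimes> k\<close> becomes the denominator.\<close>

lemma subfield_fractions:
  assumes D: "subring D R"
  shows "subfield {c \<in> carrier R. \<exists>d\<in>D - {\<zero>}. d \<otimes> c \<in> D} R" (is "subfield ?Q R")
proof -
  note DE = subringE[OF D]
  have DC: "d \<in> carrier R" if "d \<in> D" for d using DE(1) that by blast
  show ?thesis
  proof (intro subfieldI' subringI)
    show "?Q \<subseteq> carrier R" by blast
    show "\<one> \<in> ?Q" using DE(3) by (auto intro!: bexI[of _ \<one>])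
    fix h assume "h \<in> ?Q"
    then obtain d where "h \<in> carrier R" "d \<in> D" "d \<noteq> \<zero>" "d \<otimes> h \<in> D" by blast
    then show "\<ominus> h \<in> ?Q" using DE(5)[of "d \<otimes> h"] DC by (auto simp: r_minus intro!: bexI[of _ d])
  next
    fix h1 h2 assume "h1 \<in> ?Q" "h2 \<in> ?Q"
    then obtain d1 d2 where h: "h1 \<in> carrier R" "d1 \<in> D" "d1 \<noteq> \<zero>" "d1 \<otimes> h1 \<in> D"
      "h2 \<in> carrier R" "d2 \<in> D" "d2 \<noteq> \<zero>" "d2 \<otimes> h2 \<in> D" by blast
    then have C: "d1 \<in> carrier R" "d2 \<in> carrier R" using DC by auto
    have d: "d1 \<otimes> d2 \<in> D - {\<zero>}" using h C DE(6) integral by blast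
    have "(d1 \<otimes> d2) \<otimes> (h1 \<otimes> h2) = (d1 \<otimes> h1) \<otimes> (d2 \<otimes> h2)"
      using h C by algebra
    then have "(d1 \<otimes> d2) \<otimes> (h1 \<otimes> h2) \<in> D" using DE(6) h by simp
    then show "h1 \<otimes> h2 \<in> ?Q" using d h by auto
    have "(d1 \<otimes> d2) \<otimes> (h1 \<oplus> h2) = d2 \<otimes> (d1 \<otimes> h1) \<oplus> d1 \<otimes> (d2 \<otimes> h2)"
      using h C by algebra
    then have "(d1 \<otimes> d2) \<otimes> (h1 \<oplus> h2) \<in> D" using DE(6,7) h by simp
    then show "h1 \<oplus> h2 \<in> ?Q" using d h by auto
  next
    fix k assume "k \<in> ?Q - {\<zero>}"
    then obtain d where k: "k \<in> carrier R" "k \<noteq> \<zero>" "d \<in> D" "d \<noteq> \<zero>" "d \<otimes> k \<in> D" by blast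
    have ik: "inv k \<in> carrier R" "k \<otimes> inv k = \<one>" using k field_Units by auto
    have "(d \<otimes> k) \<otimes> inv k = d" using k ik DC by (simp add: m_assoc)
    moreover have "d \<otimes> k \<noteq> \<zero>" using k DC integral by blast
    ultimately show "inv k \<in> ?Q" using k ik by (auto intro!: bexI[of _ "d \<otimes> k"])
  qed
qed

text \<open>The product of the individual denominators works.\<close>

lemma common_denominator:
  assumes D: "subring D R" and "finite A" "A \<subseteq> {c \<in> carrier R. \<exists>d\<in>D - {\<zero>}. d \<otimes> c \<in> D}"
  shows "\<exists>d\<in>D - {\<zero>}. \<forall>c\<in>A. d \<otimes> c \<in> D"
  using assms(2,3)
proof (induction A)
  case empty
  then show ?case using subringE(3)[OF D] by auto
next
  case (insert a A)
  then obtain d e where d: "d \<in> D - {\<zero>}" "\<forall>c\<in>A. d \<otimes> c \<in> D" and e: "e \<in> D - {\<zero>}" "e \<otimes> a \<in> D"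
    by auto
  have C: "d \<in> carrier R" "e \<in> carrier R" using d e subringE(1)[OF D] by auto
  have "d \<otimes> e \<in> D - {\<zero>}" using d e C subringE(6)[OF D] integral by blast
  moreover have "(d \<otimes> e) \<otimes> c \<in> D" if "c \<in> insert a A" for c
  proof -
    have c: "c \<in> carrier R" using that insert.prems by blast
    have "(d \<otimes> e) \<otimes> c = d \<otimes> (e \<otimes> c)" "(d \<otimes> e) \<otimes> c = e \<otimes> (d \<otimes> c)"
      using c C by algebra+
    then show ?thesis using that d e subringE(6)[OF D] by (metis DiffD1 insertE)
  qed
  ultimately show ?case by blast
qed

text \<open>After clearing denominators, an equation for \<open>x\<close> over \<open>F(a)\<close> is a polynomial relation
  between \<open>x\<close> and \<open>a\<close>, which is read as an equation for \<open>a\<close> over \<open>F(x)\<close>.\<close>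

lemma algebraic_exchange:
  assumes F: "subfield F R" and a: "a \<in> carrier R" and x: "x \<in> carrier R"
    and alg: "(algebraic over (generate_field R (insert a F))) x" and tr: "(transcendental over F) x"
  shows "(algebraic over (generate_field R (insert x F))) a"
proof (rule ccontr)
  assume "\<not> ?thesis"
  then have tra: "(transcendental over (generate_field R (insert x F))) a" by (simp add: over_def)
  note Fr = subfieldE(1)[OF F] and FC = subfieldE(3)[OF F]
  define D where "D = simple_extension F a"
  have D: "subring D R" unfolding D_def by (rule simple_extension_is_subring[OF Fr a])
  have FD: "insert a F \<subseteq> D"
    unfolding D_def using simple_extension_mem[OF Fr a] simple_extension_incl[OF FC a] by blast
  have G: "subfield (generate_field R (insert a F)) R" "subfield (generate_field R (insert x F)) R"
    using generate_field_is_subfield a x FC by auto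
  obtain p where p: "p \<in> carrier ((generate_field R (insert a F))[X])" "p \<noteq> []" "eval p x = \<zero>"
    using algebraicE[OF subfieldE(1)[OF G(1)] x alg] by blast
  define n where "n = length p"
  have set_p: "set p \<subseteq> generate_field R (insert a F)" and lead: "lead_coeff p \<noteq> \<zero>"
    using p(1,2) unfolding sym[OF univ_poly_carrier] polynomial_def by auto
  then have pC: "set p \<subseteq> carrier R" using subfieldE(3)[OF G(1)] by blast
  \<comment> \<open>\<open>D\<close> is F[a], so F(a) consists of fractions of elements of
    \<open>D\<close>.\<close>
  have "generate_field R (insert a F) \<subseteq> {c \<in> carrier R. \<exists>d\<in>D - {\<zero>}. d \<otimes> c \<in> D}"
  proof (rule generate_field_min_subfield1[OF _ subfield_fractions[OF D]])
    show "insert a F \<subseteq> {c \<in> carrier R. \<exists>d\<in>D - {\<zero>}. d \<otimes> c \<in> D}"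
      using FD subringE(1)[OF D] by (auto intro!: bexI[of _ \<one>] simp: subringE(3)[OF D] subset_iff)
  qed (use a FC in blast)
  then obtain d where d: "d \<in> D" "d \<noteq> \<zero>" "\<forall>c\<in>set p. d \<otimes> c \<in> D"
    using common_denominator[OF D, of "set p"] set_p by blast
  have dC: "d \<in> carrier R" using d subringE(1)[OF D] by blast
  \<comment> \<open>A cleared coefficient lies in F[a], hence is the value at \<open>a\<close> of a
    polynomial over \<open>F\<close>.\<close>
  have "\<forall>i. \<exists>r. r \<in> carrier (F[X]) \<and> eval r a = d \<otimes> coeff p i"
  proof
    fix i
    have "coeff p i \<in> set p \<union> {\<zero>}" using coeff_img(3)[of p] by blast
    then have "d \<otimes> coeff p i \<in> D" using d dC subringE(2)[OF D] by auto
    then show "\<exists>r. r \<in> carrier (F[X]) \<and> eval r a = d \<otimes> coeff p i"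
      unfolding D_def simple_extension_as_eval_img[OF FC a] by auto
  qed
  then obtain r where r: "\<And>i. r i \<in> carrier (F[X])" "\<And>i. eval (r i) a = d \<otimes> coeff p i" by metis
  have rF: "set (r i) \<subseteq> F" for i
    using r(1)[of i] unfolding sym[OF univ_poly_carrier] polynomial_def by auto
  have cF: "coeff (r i) j \<in> F" for i j
  proof -
    have "coeff (r i) j \<in> set (r i) \<union> {\<zero>}" unfolding coeff_img(3)[of "r i", symmetric] by (rule rangeI)
    then show ?thesis using rF[of i] subringE(2)[OF Fr] by auto
  qed
  then have cC: "coeff (r i) j \<in> carrier R" for i j using FC by blast
  define m where "m = Max (length ` r ` {..n})"
  have eval_r: "d \<otimes> coeff p i = (\<Oplus>j\<in>{..<m}. coeff (r i) j \<otimes> a [^] j)" if "i < n" for i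
  proof -
    have "length (r i) \<le> m" unfolding m_def using that by (intro Max_ge) auto
    then show ?thesis using eval_eq_finsum[of "r i" a m] rF FC a r(2)[of i] by auto
  qed
  \<comment> \<open>Sorting d p(x) by powers of \<open>a\<close> instead of powers of
    \<open>x\<close> yields these coefficients, which lie in F(x).\<close>
  define g where "g j = (\<Oplus>i\<in>{..<n}. coeff (r i) j \<otimes> x [^] i)" for j
  have gC: "g j \<in> carrier R" for j unfolding g_def using cC x by auto
  have "(\<Oplus>j\<in>{..<m}. g j \<otimes> a [^] j)
      = (\<Oplus>j\<in>{..<m}. \<Oplus>i\<in>{..<n}. (coeff (r i) j \<otimes> a [^] j) \<otimes> x [^] i)"
  proof (intro finsum_cong')
    fix j
    have "g j \<otimes> a [^] j = (\<Oplus>i\<in>{..<n}. (coeff (r i) j \<otimes> x [^] i) \<otimes> a [^] j)"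
      unfolding g_def using cC x a by (intro finsum_ldistr) auto
    also have "\<dots> = (\<Oplus>i\<in>{..<n}. (coeff (r i) j \<otimes> a [^] j) \<otimes> x [^] i)"
      using cC x a by (intro finsum_cong') (auto simp: m_ac)
    finally show "g j \<otimes> a [^] j = (\<Oplus>i\<in>{..<n}. (coeff (r i) j \<otimes> a [^] j) \<otimes> x [^] i)" .
  qed (use cC x a in auto)
  also have "\<dots> = (\<Oplus>i\<in>{..<n}. \<Oplus>j\<in>{..<m}. (coeff (r i) j \<otimes> a [^] j) \<otimes> x [^] i)"
    using cC x a by (intro finsum_swap_nat) auto
  also have "\<dots> = (\<Oplus>i\<in>{..<n}. d \<otimes> (coeff p i \<otimes> x [^] i))"
  proof (intro finsum_cong')
    fix i assume i: "i \<in> {..<n}"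
    have "(\<Oplus>j\<in>{..<m}. (coeff (r i) j \<otimes> a [^] j) \<otimes> x [^] i) = (d \<otimes> coeff p i) \<otimes> x [^] i"
      using i eval_r[of i] cC x a finsum_ldistr[of "{..<m}" "x [^] i" "\<lambda>j. coeff (r i) j \<otimes> a [^] j"]
      by auto
    then show "(\<Oplus>j\<in>{..<m}. (coeff (r i) j \<otimes> a [^] j) \<otimes> x [^] i) = d \<otimes> (coeff p i \<otimes> x [^] i)"
      using pC dC x by (simp add: m_assoc)
  qed (use pC dC x in auto)
  also have "\<dots> = d \<otimes> eval p x"
    using pC dC x eval_eq_finsum[OF pC x, of n] finsum_rdistr[of "{..<n}" d "\<lambda>i. coeff p i \<otimes> x [^] i"]
    by (auto simp: n_def)
  finally have sum0: "(\<Oplus>j\<in>{..<m}. g j \<otimes> a [^] j) = \<zero>" using p(3) dC by simp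
  have gen: "F \<subseteq> generate_field R (insert x F)" "x \<in> generate_field R (insert x F)"
    by (auto intro: generate_field.incl)
  have g_in: "g j \<in> generate_field R (insert x F)" for j
    unfolding g_def
    using cF gen by (intro finsum_in_subring[OF subfieldE(1)[OF G(2)]]
        subringE(6)[OF subfieldE(1)[OF G(2)]] nat_pow_in_subring[OF subfieldE(1)[OF G(2)]]) auto
  \<comment> \<open>Transcendence is used twice: that of \<open>a\<close> over F(x) kills every
    \<open>g j\<close>, then that of \<open>x\<close> over \<open>F\<close> kills every coefficient
    inside \<open>g j\<close>. Thus \<open>d\<close> times the leading coefficient of
    \<open>p\<close> vanishes.\<close>
  have "g j = \<zero>" if "j < m" for j
    using transcendental_finsum_eq_zero[OF subfieldE(1)[OF G(2)] a tra g_in sum0 that] .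
  then have c0: "coeff (r i) j = \<zero>" if "i < n" "j < m" for i j
    using transcendental_finsum_eq_zero[OF Fr x tr, of n "\<lambda>i. coeff (r i) j" i] cF that
    by (simp add: g_def)
  have "d \<otimes> lead_coeff p = \<zero>"
  proof -
    have "degree p < n" using p(2) by (simp add: n_def)
    then have "d \<otimes> coeff p (degree p) = (\<Oplus>j\<in>{..<m}. \<zero>)"
      unfolding eval_r[OF \<open>degree p < n\<close>] using c0 a by (intro finsum_cong') auto
    then show ?thesis using lead_coeff_simp[OF p(2)] by simp
  qed
  then show False
    using lead d(2) dC integral[of d "lead_coeff p"] pC hd_in_set[OF p(2)] by blast
qed

end

section \<open>Relative algebraic closure of a subfield\<close>

lemma (in ring) alg_hull_iff: "x \<in> alg_hull F \<longleftrightarrow> x \<in> carrier R \<and> (algebraic over F) x"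
  by (simp add: alg_hull_def)

lemma (in ring) alg_hull_mono: "F \<subseteq> G \<Longrightarrow> alg_hull F \<subseteq> alg_hull G"
  using algebraic_mono[of F G] by (auto simp: alg_hull_iff)

context field
begin

lemma alg_hull_subfield: "subfield F R \<Longrightarrow> subfield (alg_hull F) R"
  unfolding alg_hull_def by (rule subfield_of_algebraics)

lemma alg_hull_extensive:
  assumes "subfield F R"
  shows "F \<subseteq> alg_hull F"
  using algebraic_self[OF subfieldE(1)[OF assms]] subfieldE(3)[OF assms] by (auto simp: alg_hull_iff)

text \<open>The coefficients of an equation for \<open>x\<close> generate a finite extension
  \<open>F'\<close> of \<open>F\<close>. By the tower law F'(x) is finite over \<open>F\<close>, so
  \<open>x\<close> is algebraic over \<open>F\<close>.\<close>

lemma alg_hull_idem: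
  assumes F: "subfield F R"
  shows "alg_hull (alg_hull F) \<subseteq> alg_hull F"
proof
  fix x assume "x \<in> alg_hull (alg_hull F)"
  then have x: "x \<in> carrier R" "(algebraic over (alg_hull F)) x" by (auto simp: alg_hull_iff)
  obtain p where p: "p \<in> carrier ((alg_hull F)[X])" "p \<noteq> []" "eval p x = \<zero>"
    using algebraicE[OF subfieldE(1)[OF alg_hull_subfield[OF F]] x] by blast
  have set_p: "set p \<subseteq> alg_hull F" and lead: "lead_coeff p \<noteq> \<zero>"
    using p(1,2) unfolding sym[OF univ_poly_carrier] polynomial_def by auto
  then have pC: "set p \<subseteq> carrier R" and alg: "\<And>y. y \<in> set p \<Longrightarrow> (algebraic over F) y"
    by (auto simp: alg_hull_iff)
  define F' where "F' = finite_extension F p"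
  have F': "subfield F' R" "finite_dimension F F'"
    unfolding F'_def
    using finite_extension_is_subfield[OF F pC alg] finite_extension_finite_dimension(1)[OF F pC alg]
    by auto
  have "set p \<subseteq> F'" unfolding F'_def by (rule finite_extension_mem[OF subfieldE(1)[OF F] pC])
  then have "p \<in> carrier (F'[X])"
    using lead unfolding sym[OF univ_poly_carrier] polynomial_def by auto
  then have "(algebraic over F') x" using algebraicI p(2,3) by blast
  then have "finite_dimension F' (simple_extension F' x)"
    using finite_dimension_simple_extension[OF F'(1) x(1)] by blast
  then have "finite_dimension F (simple_extension F' x)"
    using telescopic_base_dim(1)[OF F F'] by blast
  then have "(algebraic over F) x"
    using finite_dimension_imp_algebraic[OF F simple_extension_is_subring[OF subfieldE(1)[OF F'(1)] x(1)]]
      simple_extension_mem[OF subfieldE(1)[OF F'(1)] x(1)] by blast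
  then show "x \<in> alg_hull F" using x(1) by (simp add: alg_hull_iff)
qed

text \<open>Induction on how an element is generated: each step involves at most two elements, whose
  finite supports are united.\<close>

lemma generate_field_finitary:
  assumes "K \<union> S \<subseteq> carrier R" "h \<in> generate_field R (K \<union> S)"
  shows "\<exists>T\<subseteq>S. finite T \<and> h \<in> generate_field R (K \<union> T)"
  using assms(2)
proof (induction rule: generate_field.induct)
  case (incl h)
  show ?case
  proof (cases "h \<in> K")
    case True
    then show ?thesis by (intro exI[of _ "{}"]) (auto intro: generate_field.incl)
  next
    case False
    then show ?thesis using incl by (intro exI[of _ "{h}"]) (auto intro: generate_field.incl)
  qed
next
  case one
  then show ?case by (intro exI[of _ "{}"]) (auto intro: generate_field.one)
next
  case (a_inv h)
  then show ?case by (blast intro: generate_field.a_inv)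
next
  case (m_inv h)
  then show ?case by (blast intro: generate_field.m_inv)
next
  case (eng_add h1 h2)
  then obtain T1 T2 where T: "T1 \<subseteq> S" "finite T1" "h1 \<in> generate_field R (K \<union> T1)"
    "T2 \<subseteq> S" "finite T2" "h2 \<in> generate_field R (K \<union> T2)" by blast
  then have "h1 \<in> generate_field R (K \<union> (T1 \<union> T2))" "h2 \<in> generate_field R (K \<union> (T1 \<union> T2))"
    using mono_generate_field[of "K \<union> T1" "K \<union> (T1 \<union> T2)"]
      mono_generate_field[of "K \<union> T2" "K \<union> (T1 \<union> T2)"] assms(1) by blast+
  then show ?case
    using T by (intro exI[of _ "T1 \<union> T2"]) (auto intro: generate_field.eng_add)
next
  case (eng_mult h1 h2)
  then obtain T1 T2 where T: "T1 \<subseteq> S" "finite T1" "h1 \<in> generate_field R (K \<union> T1)"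
    "T2 \<subseteq> S" "finite T2" "h2 \<in> generate_field R (K \<union> T2)" by blast
  then have "h1 \<in> generate_field R (K \<union> (T1 \<union> T2))" "h2 \<in> generate_field R (K \<union> (T1 \<union> T2))"
    using mono_generate_field[of "K \<union> T1" "K \<union> (T1 \<union> T2)"]
      mono_generate_field[of "K \<union> T2" "K \<union> (T1 \<union> T2)"] assms(1) by blast+
  then show ?case
    using T by (intro exI[of _ "T1 \<union> T2"]) (auto intro: generate_field.eng_mult)
qed

lemma generate_field_finitary_set:
  assumes "K \<union> S \<subseteq> carrier R" "finite A" "A \<subseteq> generate_field R (K \<union> S)"
  shows "\<exists>T\<subseteq>S. finite T \<and> A \<subseteq> generate_field R (K \<union> T)"
  using assms(2,3)
proof (induction A)
  case (insert a A)
  then obtain T U where T: "T \<subseteq> S" "finite T" "A \<subseteq> generate_field R (K \<union> T)"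
    and U: "U \<subseteq> S" "finite U" "a \<in> generate_field R (K \<union> U)"
    using generate_field_finitary[OF assms(1), of a] by blast
  then have "insert a A \<subseteq> generate_field R (K \<union> (T \<union> U))"
    using mono_generate_field[of "K \<union> T" "K \<union> (T \<union> U)"]
      mono_generate_field[of "K \<union> U" "K \<union> (T \<union> U)"] assms(1) by blast
  then show ?case using T U by (intro exI[of _ "T \<union> U"]) auto
qed auto

text \<open>With this, exchange over the base field K(S) can be read as exchange for
  \<open>acl K\<close>.\<close>

lemma generate_field_insert:
  assumes "H \<subseteq> carrier R" "a \<in> carrier R"
  shows "generate_field R (insert a (generate_field R H)) = generate_field R (insert a H)"
proof
  have sub: "H \<subseteq> generate_field R H" by (auto intro: generate_field.incl)
  have C: "insert a (generate_field R H) \<subseteq> carrier R"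
    using generate_field_incl[OF assms(1)] assms(2) by blast
  show "generate_field R (insert a H) \<subseteq> generate_field R (insert a (generate_field R H))"
    using sub C by (intro mono_generate_field) auto
  show "generate_field R (insert a (generate_field R H)) \<subseteq> generate_field R (insert a H)"
  proof (rule generate_field_min_subfield1[OF C generate_field_is_subfield])
    show "insert a (generate_field R H) \<subseteq> generate_field R (insert a H)"
      using mono_generate_field[of H "insert a H"] assms by (auto intro: generate_field.incl)
  qed (use assms in auto)
qed

section \<open>The operator \<open>acl K\<close> and transcendence bases\<close>

context
  fixes K assumes K: "K \<subseteq> carrier R"
begin

lemma generate_field_acl_subfield: "S \<subseteq> carrier R \<Longrightarrow> subfield (generate_field R (K \<union> S)) R"
  using generate_field_is_subfield[of "K \<union> S"] K by simp

lemma acl_subfield: "S \<subseteq> carrier R \<Longrightarrow> subfield (acl K S) R"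
  unfolding acl_def by (intro alg_hull_subfield generate_field_acl_subfield)

lemma acl_closed: "S \<subseteq> carrier R \<Longrightarrow> alg_hull (acl K S) \<subseteq> acl K S"
  unfolding acl_def by (intro alg_hull_idem generate_field_acl_subfield)

lemma acl_incl:
  assumes "S \<subseteq> carrier R"
  shows "K \<union> S \<subseteq> acl K S"
proof -
  have "K \<union> S \<subseteq> generate_field R (K \<union> S)" by (rule subsetI) (rule generate_field.incl)
  also have "\<dots> \<subseteq> acl K S"
    unfolding acl_def by (rule alg_hull_extensive[OF generate_field_acl_subfield[OF assms]])
  finally show ?thesis .
qed

lemma pregeometry_acl: "pregeometry (carrier R) (acl K)"
proof
  show "acl K S \<subseteq> carrier R" for S by (auto simp: acl_def alg_hull_iff)
  show "S \<subseteq> acl K S" if "S \<subseteq> carrier R" for S using acl_incl that by blast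
  show "acl K S \<subseteq> acl K T" if T: "T \<subseteq> carrier R" and S: "S \<subseteq> acl K T" for S T
  proof -
    have "K \<union> S \<subseteq> carrier R" using K S subfieldE(3)[OF acl_subfield[OF T]] by blast
    then have "generate_field R (K \<union> S) \<subseteq> acl K T"
      using generate_field_min_subfield1[OF _ acl_subfield[OF T]] acl_incl[OF T] S by blast
    then have "acl K S \<subseteq> alg_hull (acl K T)" unfolding acl_def[of K S] by (rule alg_hull_mono)
    then show ?thesis using acl_closed[OF T] by blast
  qed
  \<comment> \<open>An equation for \<open>x\<close> has finitely many coefficients, and each needs
    only finitely many elements of \<open>S\<close>.\<close>
  show "\<exists>T\<subseteq>S. finite T \<and> x \<in> acl K T" if S: "S \<subseteq> carrier R" and x: "x \<in> acl K S" for S x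
  proof -
    have xC: "x \<in> carrier R" and alg: "(algebraic over (generate_field R (K \<union> S))) x"
      using x by (auto simp: acl_def alg_hull_iff)
    obtain p where p: "p \<in> carrier ((generate_field R (K \<union> S))[X])" "p \<noteq> []" "eval p x = \<zero>"
      using algebraicE[OF subfieldE(1)[OF generate_field_acl_subfield[OF S]] xC alg] by blast
    have set_p: "set p \<subseteq> generate_field R (K \<union> S)" and lead: "lead_coeff p \<noteq> \<zero>"
      using p(1,2) unfolding sym[OF univ_poly_carrier] polynomial_def by auto
    obtain T where T: "T \<subseteq> S" "finite T" "set p \<subseteq> generate_field R (K \<union> T)"
      using generate_field_finitary_set[OF _ _ set_p] K S by auto
    then have "p \<in> carrier ((generate_field R (K \<union> T))[X])"
      using lead unfolding sym[OF univ_poly_carrier] polynomial_def by auto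
    then have "x \<in> acl K T" using algebraicI p(2,3) xC by (auto simp: acl_def alg_hull_iff)
    then show ?thesis using T by blast
  qed
  show "a \<in> acl K (insert x S)"
    if S: "S \<subseteq> carrier R" and a: "a \<in> carrier R" and x: "x \<in> acl K (insert a S)" "x \<notin> acl K S" for S a x
  proof -
    have xC: "x \<in> carrier R" using x(1) by (auto simp: acl_def alg_hull_iff)
    have KS: "K \<union> S \<subseteq> carrier R" using K S by blast
    have eq: "generate_field R (K \<union> insert y S) = generate_field R (insert y (generate_field R (K \<union> S)))"
      if "y \<in> carrier R" for y
      using generate_field_insert[OF KS that] by simp
    have "(algebraic over (generate_field R (insert a (generate_field R (K \<union> S))))) x"
      using x(1) eq[OF a] by (simp add: acl_def alg_hull_iff)
    moreover have "(transcendental over (generate_field R (K \<union> S))) x"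
      using x(2) xC by (simp add: acl_def alg_hull_iff over_def)
    ultimately have "(algebraic over (generate_field R (insert x (generate_field R (K \<union> S))))) a"
      by (rule algebraic_exchange[OF generate_field_acl_subfield[OF S] a xC])
    then show ?thesis using eq[OF xC] a by (simp add: acl_def alg_hull_iff)
  qed
qed

text \<open>Transcendental means not algebraic, so the results on independent sets of a pregeometry
  apply to algebraic independence over \<open>K\<close>.\<close>

lemma indep_acl_iff: "pregeometry.indep (carrier R) (acl K) = alg_independent K"
proof
  fix S
  show "pregeometry.indep (carrier R) (acl K) S \<longleftrightarrow> alg_independent K S"
    unfolding pregeometry.indep_def[OF pregeometry_acl] alg_independent_def acl_def alg_hull_iff over_def
    by blast
qed

text \<open>Since some basis exists, the choice made in \<open>tr_deg\<close> is a genuine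
  transcendence basis.\<close>

lemma tr_deg_basis:
  assumes "L \<subseteq> carrier R"
  obtains B where "B \<subseteq> L" "alg_independent K B" "L \<subseteq> acl K B" "tr_deg K L = |B|"
proof -
  have "\<exists>B. transcendence_basis K L B"
    using pregeometry.basis_exists[OF pregeometry_acl assms]
    by (simp add: transcendence_basis_def indep_acl_iff)
  then have "transcendence_basis K L (SOME B. transcendence_basis K L B)" by (rule someI_ex)
  then show ?thesis using that unfolding transcendence_basis_def[of K L] tr_deg_def by blast
qed

end

subsection \<open>Minimal polynomials and generic elements\<close>

text \<open>If \<open>w\<close> lies in \<open>F\<close> only and \<open>b\<close> avoids \<open>F\<close>, then some \<open>b \<oplus> w [^] n\<close> avoids all members: otherwise
  two of them would share a member, over which \<open>w\<close> would be algebraic.\<close>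

lemma subring_avoids_closed_subfields:
  assumes "finite \<F>" and W: "subring W R"
    and "\<And>F. F \<in> \<F> \<Longrightarrow> subfield F R \<and> alg_hull F \<subseteq> F \<and> \<not> W \<subseteq> F"
  shows "\<exists>w\<in>W. w \<notin> \<Union>\<F>"
  using assms(1,3)
proof (induction \<F>)
  case empty
  then show ?case using subringE(3)[OF W] by blast
next
  case (insert F \<F>)
  obtain w where w: "w \<in> W" "w \<notin> \<Union>\<F>" using insert.IH insert.prems by blast
  obtain b where b: "b \<in> W" "b \<notin> F" using insert.prems by blast
  have F: "subfield F R" using insert.prems by blast
  have wC: "w \<in> carrier R" and bC: "b \<in> carrier R" using w b subringE(1)[OF W] by auto
  show ?case
  proof (rule ccontr)
    assume con: "\<not> ?thesis"
    \<comment> \<open>As \<open>w\<close> avoids every member of \<open>\<F>\<close>, it can fail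
      only by lying in \<open>F\<close>.\<close>
    then have wF: "w \<in> F" using w by blast
    let ?u = "\<lambda>n::nat. b \<oplus> w [^] n"
    have "?u n \<in> W" for n using b w subringE(7)[OF W] nat_pow_in_subring[OF W] by blast
    moreover have "?u n \<notin> F" for n
    proof
      assume "?u n \<in> F"
      moreover have wn: "w [^] n \<in> F" using nat_pow_in_subring[OF subfieldE(1)[OF F] wF] .
      ultimately have "?u n \<oplus> \<ominus> (w [^] n) \<in> F"
        using subringE(5,7)[OF subfieldE(1)[OF F]] by blast
      then show False using b(2) wC bC by (simp add: a_assoc r_neg)
    qed
    ultimately have "\<exists>G\<in>\<F>. ?u n \<in> G" for n using con by blast
    then obtain G where G: "\<And>n. G n \<in> \<F>" "\<And>n. ?u n \<in> G n" by metis
    \<comment> \<open>Pigeonhole: infinitely many exponents, finitely many subfields. Exponents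
      start at 1 so that \<open>m - 1\<close> below is a true predecessor.\<close>
    have "\<not> inj_on G {1..}"
    proof
      assume "inj_on G {1..}"
      moreover have "finite (G ` {1..})" using G(1) insert.hyps(1) by (auto intro: finite_subset)
      ultimately have "finite {1::nat..}" by (rule finite_imageD[rotated])
      then show False using infinite_Ici by blast
    qed
    then obtain m n where mn: "1 \<le> m" "m < n" "G m = G n"
      unfolding inj_on_def by (metis atLeast_iff linorder_neqE_nat)
    let ?G = "G n"
    have H: "subfield ?G R" "alg_hull ?G \<subseteq> ?G" using insert.prems G(1) by auto
    note HE = subringE[OF subfieldE(1)[OF H(1)]]
    define f where "f = ?u n \<ominus> ?u m"
    have f: "f \<in> ?G" unfolding f_def minus_eq using HE(5,7) G(2)[of n] G(2)[of m] mn(3) by simp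
    have fw: "f = w [^] n \<ominus> w [^] m" 
    proof -
      have "(b \<oplus> y) \<ominus> (b \<oplus> z) = y \<ominus> z" if "y \<in> carrier R" "z \<in> carrier R" for y z
        using that bC by algebra
      then show ?thesis unfolding f_def using wC by simp
    qed
    \<comment> \<open>The coefficient list of X^n - X^m - f, leading coefficient first, in blocks of
      lengths n - m, m and 1.\<close>
    define p where "p = monom \<one> (n - m - 1) @ monom (\<ominus> \<one>) (m - 1) @ [\<ominus> f]"
    have fC: "f \<in> carrier R" using f HE(1) by blast
    have pC: "set p \<subseteq> ?G" using HE(2,3) HE(5)[OF HE(3)] HE(5)[OF f] by (auto simp: p_def monom_def)
    then have "p \<in> carrier (?G[X])"
      unfolding sym[OF univ_poly_carrier] polynomial_def by (auto simp: p_def monom_def)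
    moreover have "eval p w = \<zero>"
    proof -
      have mc: "set (monom c k) \<subseteq> carrier R" if "c \<in> carrier R" for c k
        using that by (auto simp: monom_def)
      have len: "length (monom (\<ominus> \<one>) (m - 1) @ [\<ominus> f]) = m + 1"
        using mn(1) by (simp add: monom_def)
      have "\<ominus> \<one> \<otimes> w [^] (m - 1) \<otimes> w = \<ominus> (w [^] m)"
        using nat_pow_Suc[of w "m - 1"] mn(1) wC by (simp add: l_minus)
      then have "eval (monom (\<ominus> \<one>) (m - 1) @ [\<ominus> f]) w = \<ominus> (w [^] m) \<oplus> \<ominus> f"
        using eval_append_aux[OF mc[of "\<ominus> \<one>" "m - 1"], of "\<ominus> f" w]
          eval_monom[of "\<ominus> \<one>" w "m - 1"] wC fC by simp
      moreover have "w [^] (n - m - 1) \<otimes> w [^] (m + 1) = w [^] n"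
      proof -
        have "n - m - 1 + (m + 1) = n" using mn by simp
        then show ?thesis using nat_pow_mult[OF wC, of "n - m - 1" "m + 1"] by metis
      qed
      moreover have "set (monom (\<ominus> \<one>) (m - 1) @ [\<ominus> f]) \<subseteq> carrier R"
        using mc[of "\<ominus> \<one>" "m - 1"] fC by simp
      ultimately have "eval p w = w [^] n \<oplus> (\<ominus> (w [^] m) \<oplus> \<ominus> f)"
        unfolding p_def
        using eval_append[OF mc[of \<one> "n - m - 1"], of "monom (\<ominus> \<one>) (m - 1) @ [\<ominus> f]" w, unfolded len]
          eval_monom[of \<one> w "n - m - 1"] wC by simp
      also have "\<dots> = \<zero>"
      proof -
        have "y \<oplus> (\<ominus> z \<oplus> \<ominus> (y \<ominus> z)) = \<zero>" if "y \<in> carrier R" "z \<in> carrier R" for y z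
          using that by algebra
        then show ?thesis unfolding fw using wC by simp
      qed
      finally show ?thesis .
    qed
    ultimately have "w \<in> alg_hull ?G"
      using algebraicI[of p] wC by (auto simp: alg_hull_iff p_def)
    then show False using H(2) w(2) G(1) by blast
  qed
qed

end

text \<open>Here \<open>L\<close> is the ambient algebraically closed field, so \<open>p\<close> is
  a product of factors X - a with all roots a in \<open>H\<close>; induction on the degree splits
  off one factor at a time.\<close>

lemma (in algebraically_closed) monic_coeffs_in_subfield:
  assumes H: "subfield H L"
    and "p \<in> carrier (poly_ring L)" "p \<noteq> []" "lead_coeff p = \<one>" "\<And>r. is_root p r \<Longrightarrow> r \<in> H"
  shows "set p \<subseteq> H"
  using assms(2-5)
proof (induction "degree p" arbitrary: p rule: less_induct)
  case less
  note HE = subringE[OF subfieldE(1)[OF H]]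
  interpret UP: domain "poly_ring L" using univ_poly_is_domain[OF carrier_is_subring] .
  have p_ne: "p \<noteq> []" by fact
  show ?case
  proof (cases "degree p = 0")
    case True
    then have "p = [\<one>]" using p_ne less.prems(3) by (cases p) auto
    then show ?thesis using HE(3) by simp
  next
    case False
    \<comment> \<open>A split polynomial has as many roots, counted with multiplicity, as its
      degree.\<close>
    have "splitted p" using roots_over_carrier less.prems(1) by blast
    then have "roots p \<noteq> {#}" using False by (auto simp: splitted_def)
    then obtain a where a: "a \<in> carrier L" "a \<in># roots p" "[\<one>, \<ominus> a] \<in> carrier (poly_ring L)"
      "[\<one>, \<ominus> a] pdivides p"
      using not_empty_rootsE[OF less.prems(1)] by blast
    then obtain q where q: "q \<in> carrier (poly_ring L)" "p = [\<one>, \<ominus> a] \<otimes>\<^bsub>poly_ring L\<^esub> q"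
      unfolding pdivides_def factor_def by blast
    have pm: "p = poly_mult [\<one>, \<ominus> a] q" using q(2) by (simp add: univ_poly_mult)
    have q_ne: "q \<noteq> []" using p_ne pm poly_mult_zero(2)[of "[\<one>, \<ominus> a]"] a(1) by auto
    have pol: "polynomial (carrier L) [\<one>, \<ominus> a]" "polynomial (carrier L) q"
      using a(3) q(1) by (simp_all add: univ_poly_carrier)
    have "degree p = 1 + degree q"
      using poly_mult_degree_eq[OF carrier_is_subring pol] q_ne pm by simp
    moreover have "lead_coeff q = \<one>"
    proof -
      have "lead_coeff q \<in> carrier L" using pol(2) q_ne by (auto simp: polynomial_def)
      moreover have "lead_coeff p = lead_coeff [\<one>, \<ominus> a] \<otimes> lead_coeff q"
        using poly_mult_lead_coeff[OF carrier_is_subring pol _ q_ne] pm by simp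
      ultimately show ?thesis using less.prems(3) by simp
    qed
    moreover have "r \<in> H" if "is_root q r" for r
    proof -
      have "q pdivides p"
        unfolding pdivides_def factor_def using q a(3) UP.m_comm[OF a(3) q(1)] by blast
      then have "is_root p r"
        using pdivides_imp_root_sharing[OF q(1)] that p_ne by (auto simp: is_root_def)
      then show ?thesis using less.prems(4) by blast
    qed
    ultimately have "set q \<subseteq> H" using less.hyps[of q] q(1) q_ne by simp
    then have "polynomial H q" using pol(2) by (auto simp: polynomial_def)
    moreover have "a \<in> H" using less.prems(1,4) a(2) roots_mem_iff_is_root by blast
    then have "polynomial H [\<one>, \<ominus> a]" using HE(3) HE(5)[of a] by (simp add: polynomial_def)
    ultimately have "polynomial H p"
      unfolding pm using poly_mult_closed[OF subfieldE(1)[OF H]] by blast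
    then show ?thesis by (rule polynomial_incl)
  qed
qed

section \<open>Coefficients of minimal polynomials, traces and transcendence degree\<close>

context algebraically_closed
begin

text \<open>The minimal polynomial over \<open>M\<close> divides the one over \<open>F\<close>, so
  all its roots are algebraic over \<open>F\<close>; being monic, it then has its coefficients in
  \<open>alg_hull F\<close>.\<close>

lemma Irr_coeffs_in_alg_hull:
  assumes F: "subfield F L" and M: "subfield M L" and "F \<subseteq> M" and x: "x \<in> alg_hull F"
  shows "set (Irr M x) \<subseteq> alg_hull F"
proof -
  have xC: "x \<in> carrier L" and algF: "(algebraic over F) x" using x by (simp_all add: alg_hull_iff)
  have algM: "(algebraic over M) x" using algebraic_mono[OF \<open>F \<subseteq> M\<close> algF] .
  note IF = IrrE[OF F xC algF] and IM = IrrE[OF M xC algM]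
  have "Irr F x \<in> carrier (M[X])"
    using IF(1) \<open>F \<subseteq> M\<close> unfolding sym[OF univ_poly_carrier] polynomial_def by blast
  then have dvd: "Irr M x pdivides Irr F x" using Irr_minimal[OF M xC algM _ IF(4)] by blast
  have ne: "Irr M x \<noteq> []" "Irr F x \<noteq> []"
    using IM(2) IF(2) unfolding ring_irreducible_def univ_poly_zero by auto
  have PM: "Irr M x \<in> carrier (poly_ring L)"
    using carrier_polynomial_shell[OF subfieldE(1)[OF M] IM(1)] .
  show ?thesis
  proof (rule monic_coeffs_in_subfield[OF alg_hull_subfield[OF F] PM ne(1) IM(3)])
    fix r assume "is_root (Irr M x) r"
    then have "r \<in> carrier L" "eval (Irr F x) r = \<zero>"
      using pdivides_imp_root_sharing[OF PM dvd] by (auto simp: is_root_def)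
    then show "r \<in> alg_hull F" using algebraicI[OF IF(1) ne(2)] by (simp add: alg_hull_iff)
  qed
qed

text \<open>The minimal polynomial of \<open>x\<close> over \<open>M\<close> has its coefficients in every \<open>acl K S\<close> that contains
  \<open>x\<close>, and these coefficients generate \<open>x\<close> algebraically; a generic element of the field of
  candidates \<open>W\<close> therefore lies in no further \<open>acl K S\<close>.\<close>

lemma acl_trace_realized:
  assumes K: "subfield K L" and M: "subfield M L" and "K \<subseteq> M"
    and A: "finite A" "A \<subseteq> M" and x: "x \<in> acl K A"
  shows "\<exists>x'\<in>M. \<forall>S\<subseteq>A. x \<in> acl K S \<longleftrightarrow> x' \<in> acl K S"
proof -
  have KC: "K \<subseteq> carrier L" and MC: "M \<subseteq> carrier L" using subfieldE(3) K M by auto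
  have sC: "S \<subseteq> carrier L" if "S \<subseteq> A" for S using that A(2) MC by blast
  \<comment> \<open>Elements of \<open>M\<close> whose trace contains that of \<open>x\<close>; the
    members of \<open>\<F>\<close> are the closed fields that must be avoided for equality.\<close>
  define W where "W = \<Inter>(insert M (acl K ` {S. S \<subseteq> A \<and> x \<in> acl K S}))"
  define \<F> where "\<F> = acl K ` {S. S \<subseteq> A \<and> x \<notin> acl K S}"
  have W: "subring W L"
    unfolding W_def
    by (rule subring_Inter) (use subfieldE(1) M acl_subfield[OF KC sC] in auto)
  have xC: "x \<in> carrier L" using x by (simp add: acl_def alg_hull_iff)
  have gen: "generate_field L (K \<union> S) \<subseteq> M" if "S \<subseteq> A" for S
    using generate_field_min_subfield1[OF _ M, of "K \<union> S"] that A(2) \<open>K \<subseteq> M\<close> MC by blast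
  have algM: "(algebraic over M) x"
    using algebraic_mono[OF gen[of A]] x by (simp add: acl_def alg_hull_iff)
  have Irr_W: "set (Irr M x) \<subseteq> W"
  proof -
    have "set (Irr M x) \<subseteq> M"
      using IrrE(1)[OF M xC algM] unfolding sym[OF univ_poly_carrier] polynomial_def by auto
    moreover have "set (Irr M x) \<subseteq> acl K S" if "S \<subseteq> A" "x \<in> acl K S" for S
      using Irr_coeffs_in_alg_hull[OF generate_field_acl_subfield[OF KC sC[OF that(1)]] M gen[OF that(1)]]
        that(2) unfolding acl_def .
    ultimately show ?thesis unfolding W_def by blast
  qed
  have "\<exists>w\<in>W. w \<notin> \<Union>\<F>"
  proof (rule subring_avoids_closed_subfields[OF _ W])
    show "finite \<F>" using A(1) by (simp add: \<F>_def)
    fix F assume "F \<in> \<F>"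
    then obtain S where S: "S \<subseteq> A" "x \<notin> acl K S" and F: "F = acl K S" by (auto simp: \<F>_def)
    \<comment> \<open>Otherwise \<open>F\<close> contains the coefficients of the minimal polynomial
      of \<open>x\<close>, and being algebraically closed in the ambient field it contains
      \<open>x\<close>.\<close>
    have "\<not> W \<subseteq> F"
    proof
      assume "W \<subseteq> F"
      then have "Irr M x \<in> carrier (F[X])"
        using IrrE(1)[OF M xC algM] Irr_W unfolding sym[OF univ_poly_carrier] polynomial_def by auto
      moreover have "Irr M x \<noteq> []"
        using IrrE(2)[OF M xC algM] unfolding ring_irreducible_def univ_poly_zero by auto
      ultimately have "x \<in> alg_hull F"
        using algebraicI IrrE(4)[OF M xC algM] xC by (simp add: alg_hull_iff)
      then show False using acl_closed[OF KC sC[OF S(1)]] S(2) F by blast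
    qed
    then show "subfield F L \<and> alg_hull F \<subseteq> F \<and> \<not> W \<subseteq> F"
      using acl_subfield[OF KC sC[OF S(1)]] acl_closed[OF KC sC[OF S(1)]] F by blast
  qed
  then obtain w where "w \<in> W" "w \<notin> \<Union>\<F>" by blast
  then show ?thesis unfolding W_def \<F>_def by (intro bexI[of _ w]) auto
qed

text \<open>A finite spanning set makes the transcendence degree of \<open>M\<close> finite, hence
  equal to that of \<open>N\<close>. A basis of \<open>M\<close> then has the largest size possible
  in \<open>N\<close>, so it spans \<open>N\<close> as well.\<close>

lemma acl_spanning_transfer:
  assumes K: "K \<subseteq> carrier L" and N: "N \<subseteq> carrier L" and "M \<subseteq> N"
    and deg: "(tr_deg K M =o tr_deg K N \<and> tr_deg K N <o natLeq) \<or>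
      (natLeq \<le>o tr_deg K M \<and> natLeq \<le>o tr_deg K N)"
    and A: "finite A" "A \<subseteq> carrier L" "M \<subseteq> acl K A"
  shows "N \<subseteq> acl K A"
proof -
  interpret pregeometry "carrier L" "acl K" by (rule pregeometry_acl[OF K])
  have MC: "M \<subseteq> carrier L" using N \<open>M \<subseteq> N\<close> by blast
  obtain B where B: "B \<subseteq> M" "alg_independent K B" "M \<subseteq> acl K B" "tr_deg K M = |B|"
    using tr_deg_basis[OF K MC] .
  obtain B' where B': "B' \<subseteq> N" "alg_independent K B'" "N \<subseteq> acl K B'" "tr_deg K N = |B'|"
    using tr_deg_basis[OF K N] .
  have ind: "indep B" using B(2) indep_acl_iff[OF K] by simp
  have "finite B" using indep_card_le[OF A(1,2) ind] B(1) A(3) by blast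
  \<comment> \<open>This rules out the alternative in which both degrees are infinite.\<close>
  then have "\<not> natLeq \<le>o |B|" using infinite_iff_natLeq_ordLeq by blast
  then have "|B| =o |B'|" "|B'| <o natLeq" using deg B(4) B'(4) by auto
  then have fin': "finite B'" and card: "card B = card B'"
    using finite_iff_ordLess_natLeq card_of_ordIso[of B B'] bij_betw_same_card by blast+
  show ?thesis
  proof
    fix y assume y: "y \<in> N"
    have BA: "acl K B \<subseteq> acl K A" using cl_least[OF A(2)] B(1) A(3) by blast
    have "y \<in> acl K B"
    \<comment> \<open>Adding \<open>y\<close> to \<open>B\<close> would give an independent subset
      of \<open>N\<close> larger than the basis \<open>B'\<close>.\<close>
    proof (rule ccontr)
      assume n: "y \<notin> acl K B"
      then have "y \<notin> B" using cl_extensive[of B] B(1) MC by blast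
      have "indep (insert y B)" using indep_insert[OF ind _ n] y N by blast
      moreover have "insert y B \<subseteq> acl K B'" using y B(1) B'(3) \<open>M \<subseteq> N\<close> by blast
      ultimately have "card (insert y B) \<le> card B'"
        using indep_card_le[OF fin'] B'(1) N by blast
      then show False using \<open>y \<notin> B\<close> \<open>finite B\<close> card by simp
    qed
    then show "y \<in> acl K A" using BA by blast
  qed
qed

end

subsection \<open>Elementarity for one quantifier\<close>

theorem theorem3p2:
  fixes C :: "('a, 'b) ring_scheme" and K L\<^sub>1 L\<^sub>2 :: "'a set"
  assumes "algebraically_closed C"
    and "subfield K C" and "subfield L\<^sub>1 C" and "subfield L\<^sub>2 C"
    and "K \<subseteq> L\<^sub>1" and "L\<^sub>1 \<subseteq> L\<^sub>2"
    and "(ring.tr_deg C K L\<^sub>1 =o ring.tr_deg C K L\<^sub>2 \<and> ring.tr_deg C K L\<^sub>2 <o natLeq) \<or>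
         (natLeq \<le>o ring.tr_deg C K L\<^sub>1 \<and> natLeq \<le>o ring.tr_deg C K L\<^sub>2)"
  shows "ring.acl_struct C K L\<^sub>1 \<prec>\<^sub>1 ring.acl_struct C K L\<^sub>2"
proof -
  interpret C: algebraically_closed C by fact
  have KC: "K \<subseteq> carrier C" and L1C: "L\<^sub>1 \<subseteq> carrier C" and L2C: "L\<^sub>2 \<subseteq> carrier C"
    using subfieldE(3) assms(2-4) by auto
  interpret pregeometry "carrier C" "C.acl K" by (rule C.pregeometry_acl[OF KC])
  have univ: "universe (C.acl_struct K L) = L" and rel: "acl_rel (C.acl_struct K L) = (\<lambda>a as. a \<in> C.acl K (set as))"
    for L by (simp_all add: C.acl_struct_def)
  have trace: "\<exists>x'\<in>L\<^sub>1. \<forall>S\<subseteq>A. x \<in> C.acl K S \<longleftrightarrow> x' \<in> C.acl K S"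
    if A: "finite A" "A \<subseteq> L\<^sub>1" and x: "x \<in> L\<^sub>2" for A x
  proof (cases "x \<in> C.acl K A")
    case True
    then show ?thesis using C.acl_trace_realized[OF assms(2,3,5) A] by blast
  next
    case False
    have AC: "A \<subseteq> carrier C" using A(2) L1C by blast
    \<comment> \<open>If \<open>A\<close> spanned \<open>L\<^sub>1\<close>, it would span
      \<open>L\<^sub>2\<close> and hence \<open>x\<close>.\<close>
    have "\<not> L\<^sub>1 \<subseteq> C.acl K A"
      using C.acl_spanning_transfer[OF KC L2C assms(6,7) A(1) AC] False x by blast
    then obtain x' where "x' \<in> L\<^sub>1" "x' \<notin> C.acl K A" by blast
    \<comment> \<open>By monotonicity, points outside \<open>acl K A\<close> lie in no
      \<open>acl K S\<close> with \<open>S \<subseteq> A\<close>, so both traces are empty.\<close>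
    then show ?thesis using False cl_mono[OF _ AC] by blast
  qed
  show ?thesis
  proof (rule elementary_sub1I, unfold univ)
    show "L\<^sub>1 \<subseteq> L\<^sub>2" by fact
    show "L\<^sub>1 \<noteq> {}" using subringE(4)[OF subfieldE(1)[OF assms(3)]] .
    fix v \<phi> e
    assume \<phi>: "quantifier_free \<phi>" "free_vars \<phi> \<subseteq> {v}" "params \<phi> \<subseteq> L\<^sub>1"
    have AC: "params \<phi> \<subseteq> carrier C" using \<phi>(3) L1C by blast
    have cong: "sat (C.acl_struct K L\<^sub>1) (e(v := x')) \<phi> \<longleftrightarrow> sat (C.acl_struct K L\<^sub>2) (e(v := x)) \<phi>"
      if "x' \<in> L\<^sub>1" "x \<in> L\<^sub>2" "\<forall>S\<subseteq>params \<phi>. x \<in> C.acl K S \<longleftrightarrow> x' \<in> C.acl K S" for x x'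
      using sat_cong_trace[OF AC _ _ _ rel rel \<phi>(1,2) order_refl, of x' x] that L1C L2C by blast
    \<comment> \<open>From \<open>L\<^sub>1\<close> to \<open>L\<^sub>2\<close> the same witness
      serves; conversely, a witness is replaced by a point of \<open>L\<^sub>1\<close> with the same
      trace over the parameters.\<close>
    show "(\<exists>a\<in>L\<^sub>1. sat (C.acl_struct K L\<^sub>1) (e(v := a)) \<phi>) \<longleftrightarrow>
      (\<exists>a\<in>L\<^sub>2. sat (C.acl_struct K L\<^sub>2) (e(v := a)) \<phi>)"
      using cong trace[OF finite_params \<phi>(3)] assms(6) by (metis subsetD)
  qed
qed

end
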